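(* Let $A$ be a finite alphabet. The subspace $\mathrm{QSym}_A$ of $\Bbbk[x_A]$ spanned by the series $M_I$, where $I$ runs over all sentences over $A$, is a subalgebra isomorphic to the graded dual algebra $(\mathrm{NSym}_A)^{gr}$, with the isomorphism given by $M_I\leftrightarrow H_I^*$.
   Context: $\Bbbk$ is a field of characteristic zero. A sentence $I=(w_1,\dots,w_m)$ over $A$ is a finite sequence of non-empty words in letters of $A$; $1$ is the empty sentence; $|I|$ is the total number of letters; $I\cdot J$ is concatenation of sequences of words. $\mathrm{NSym}_A$ is the Hopf algebra over $\Bbbk$ with linear basis $(H_I)$ indexed by sentences, graded by $|I|$, with product $H_I\cdot H_J=H_{I\cdot J}$ and coproduct $\Delta(H_I)=\sum_{J\subset I}H_{\widetilde{I\setminus J}}\otimes H_{\widetilde J}$. Here, for $I=(w_1,\dots,w_m)$, $J=(v_1,\dots,v_m)$ runs over sequences of possibly empty words such that $w_i=u_iv_i$ for some words $u_i$; $I\setminus J=(u_1,\dots,u_m)$; and tilde means deleting the empty words. Its graded dual $(\mathrm{NSym}_A)^{gr}$ has the basis $(H_I^* )$ dual to $(H_I)$, and its product is dual to $\Delta$, i.e. $\langle fg,h\rangle=\langle f\otimes g,\Delta(h)\rangle$. Partially commutative variables: $x_A=\{x_{a,i}: a\in A,\ i=1,2,3,\dots\}$, each variable of degree $1$, subject to the relations $x_{a,i}x_{b,j}=x_{b,j}x_{a,i}$ for $i\ne j$ and $a,b\in A$ only (for $a\neq b$ the variables $x_{a,i}$ and $x_{b,i}$ do not commute). $\Bbbk[x_A]$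 is the algebra of formal (possibly infinite) $\Bbbk$-linear combinations, of bounded degree, of monomials in these variables, with the natural multiplication. For a word $w=a_{i_1}\cdots a_{i_k}$ and $j\ge 1$ put $x_{w,j}=x_{a_{i_1},j}x_{a_{i_2},j}\cdots x_{a_{i_k},j}$. For a sentence $I=(w_1,\dots,w_m)$ put $$M_I=\sum_{1\le j_1<j_2<\dots<j_m}x_{w_1,j_1}x_{w_2,j_2}\cdots x_{w_m,j_m},\qquad M_1=1 .$$ *)

theory Defs
  imports
    "HOL-Algebra.Subrings"
    "HOL-Algebra.Module"
    "HOL-Library.Multiset"
    "HOL-Library.Sublist"
    "HOL-Library.Function_Algebras"
    "HOL-Library.Poly_Mapping"
begin

section \<open>Algebras over a field\<close>

text \<open>
  Algebras over a ground field given as a type \<open>'k\<close> are presented as records of type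
  \<open>('k, 'v) module\<close>, so that the notions of subring and ring isomorphism
  of HOL-Algebra apply to their underlying rings.
\<close>

definition is_subalgebra :: "'v set \<Rightarrow> ('k, 'v) module \<Rightarrow> bool" where
  "is_subalgebra H R \<longleftrightarrow> subring H R \<and> (\<forall>c. \<forall>x\<in>H. c \<odot>\<^bsub>R\<^esub> x \<in> H)"

definition algebra_iso :: "('k, 'v) module \<Rightarrow> ('k, 'w) module \<Rightarrow> ('v \<Rightarrow> 'w) set" where
  "algebra_iso R S =
     {h \<in> ring_iso R S. \<forall>c. \<forall>x\<in>carrier R. h (c \<odot>\<^bsub>R\<^esub> x) = c \<odot>\<^bsub>S\<^esub> h x}"


section \<open>Sentences\<close>

type_synonym 'a sentence = "'a list list"

definition sentences :: "'a set \<Rightarrow> 'a sentence set" where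
  "sentences A = lists (lists A - {[]})"

definition letters :: "'a sentence \<Rightarrow> nat" where
  "letters I = sum_list (map length I)"

definition tilde :: "'a sentence \<Rightarrow> 'a sentence" where
  "tilde I = filter (\<lambda>w. w \<noteq> []) I"

definition subsentences :: "'a sentence \<Rightarrow> 'a list list set" where
  "subsentences I = {J. list_all2 suffix J I}"

text \<open>For \<open>w = u @ v\<close> the word \<open>u\<close> is the prefix of \<open>w\<close> of length \<open>length w - length v\<close>.\<close>

definition sminus :: "'a sentence \<Rightarrow> 'a list list \<Rightarrow> 'a list list" where
  "sminus I J = map2 (\<lambda>w v. take (length w - length v) w) I J"


section \<open>The coalgebra of noncommutative symmetric functions and its graded dual algebra\<close>

text \<open>
  An element of \<open>NSym\<^sub>A\<close> is given by its finitely many coefficients in the basis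
  \<open>(H\<^sub>I)\<close>, and an element of the tensor square by its coefficients in the basis
  \<open>(H\<^sub>I \<otimes> H\<^sub>J)\<close>.
\<close>

definition nsym :: "'a set \<Rightarrow> ('a sentence \<Rightarrow>\<^sub>0 'k::field) set" where
  "nsym A = {p. Poly_Mapping.keys p \<subseteq> sentences A}"

definition H_basis :: "'a sentence \<Rightarrow> ('a sentence \<Rightarrow>\<^sub>0 'k::field)" where
  "H_basis I = Poly_Mapping.single I 1"

definition nsym_homogeneous :: "'a set \<Rightarrow> nat \<Rightarrow> ('a sentence \<Rightarrow>\<^sub>0 'k::field) set" where
  "nsym_homogeneous A n = {p \<in> nsym A. \<forall>I\<in>Poly_Mapping.keys p. letters I = n}"

definition coproduct ::
    "('a sentence \<Rightarrow>\<^sub>0 'k::field) \<Rightarrow> ('a sentence \<times> 'a sentence \<Rightarrow>\<^sub>0 'k)" where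
  "coproduct p = (\<Sum>I\<in>Poly_Mapping.keys p. \<Sum>J\<in>subsentences I.
     Poly_Mapping.single (tilde (sminus I J), tilde J) (Poly_Mapping.lookup p I))"

definition tensor_functional ::
    "(('a sentence \<Rightarrow>\<^sub>0 'k::field) \<Rightarrow> 'k) \<Rightarrow> (('a sentence \<Rightarrow>\<^sub>0 'k) \<Rightarrow> 'k) \<Rightarrow>
     ('a sentence \<times> 'a sentence \<Rightarrow>\<^sub>0 'k) \<Rightarrow> 'k" where
  "tensor_functional f g t =
     (\<Sum>(I, J)\<in>Poly_Mapping.keys t. Poly_Mapping.lookup t (I, J) * (f (H_basis I) * g (H_basis J)))"

text \<open>
  The functionals on \<open>NSym\<^sub>A\<close> are represented by HOL functions that are \<open>0\<close> outside
  \<^term>\<open>nsym A\<close>. The graded dual consists of the linear functionals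
  that vanish on all but finitely many homogeneous components.
\<close>

definition nsym_functional :: "'a set \<Rightarrow> (('a sentence \<Rightarrow>\<^sub>0 'k::field) \<Rightarrow> 'k) \<Rightarrow> bool" where
  "nsym_functional A f \<longleftrightarrow>
     (\<forall>p\<in>nsym A. \<forall>q\<in>nsym A. f (p + q) = f p + f q) \<and>
     (\<forall>c. \<forall>p\<in>nsym A. f (Poly_Mapping.map (\<lambda>x. c * x) p) = c * f p) \<and>
     (\<forall>p. p \<notin> nsym A \<longrightarrow> f p = 0)"

definition H_dual :: "'a set \<Rightarrow> 'a sentence \<Rightarrow> ('a sentence \<Rightarrow>\<^sub>0 'k::field) \<Rightarrow> 'k" where
  "H_dual A I = (\<lambda>p. if p \<in> nsym A then Poly_Mapping.lookup p I else 0)"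

text \<open>The unit of the dual algebra is the counit of \<open>NSym\<^sub>A\<close>, which is \<open>H\<^sub>1\<^sup>*\<close>.\<close>

definition nsym_gdual :: "'a set \<Rightarrow> ('k::field, ('a sentence \<Rightarrow>\<^sub>0 'k) \<Rightarrow> 'k) module" where
  "nsym_gdual A = \<lparr>
     carrier = {f. nsym_functional A f \<and>
                   finite {n. \<exists>p\<in>nsym_homogeneous A n. f p \<noteq> 0}},
     monoid.mult = (\<lambda>f g p. if p \<in> nsym A then tensor_functional f g (coproduct p) else 0),
     one = H_dual A [],
     zero = (\<lambda>p. 0),
     add = (\<lambda>f g p. f p + g p),
     smult = (\<lambda>c f p. c * f p)\<rparr>"


section \<open>Partially commutative monomials\<close>

text \<open>
  The pair \<open>(a, i)\<close> stands for the variable \<open>x\<^sub>a\<^sub>,\<^sub>i\<close>. Monomials are words in the variables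
  modulo the congruence generated by the commutation relations. Indices range over all
  natural numbers here; the algebra of series below uses the indices \<open>i \<ge> 1\<close> only.
\<close>

inductive pc_swap :: "('a \<times> nat) list \<Rightarrow> ('a \<times> nat) list \<Rightarrow> bool" where
  "i \<noteq> j \<Longrightarrow> pc_swap (u @ [(a, i), (b, j)] @ v) (u @ [(b, j), (a, i)] @ v)"

quotient_type 'a pc_monomial = "('a \<times> nat) list" / "equivclp pc_swap"
  by (rule equivp_evquivclp)

lemma pc_swap_append: "pc_swap u v \<Longrightarrow> pc_swap (r @ u @ s) (r @ v @ s)"
proof (induction rule: pc_swap.induct)
  case (1 i j u a b v)
  then show ?case using pc_swap.intros[of i j "r @ u" a b "v @ s"] by simp
qed

lemma equivclp_pc_swap_append:
  "equivclp pc_swap u v \<Longrightarrow> equivclp pc_swap (r @ u @ s) (r @ v @ s)"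
proof (induction rule: equivclp_induct)
  case base
  then show ?case by simp
next
  case (step y z)
  then have "equivclp pc_swap (r @ y @ s) (r @ z @ s)"
    by (meson equivclp_sym pc_swap_append r_into_equivclp)
  with step show ?case by (meson equivclp_trans)
qed

lemma equivclp_pc_swap_mset: "equivclp pc_swap u v \<Longrightarrow> mset u = mset v"
  by (induction rule: equivclp_induct) (auto elim!: pc_swap.cases)

instantiation pc_monomial :: (type) monoid_mult
begin

lift_definition one_pc_monomial :: "'a pc_monomial" is "[]" .

lift_definition times_pc_monomial :: "'a pc_monomial \<Rightarrow> 'a pc_monomial \<Rightarrow> 'a pc_monomial" is "(@)"
proof -
  fix u u' v v' :: "('a \<times> nat) list"
  assume "equivclp pc_swap u u'" "equivclp pc_swap v v'"
  then show "equivclp pc_swap (u @ v) (u' @ v')"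
    using equivclp_pc_swap_append[of u u' "[]" v] equivclp_pc_swap_append[of v v' u' "[]"]
    by (auto intro: equivclp_trans)
qed

instance
  by standard (transfer; simp)+

end

lift_definition pc_var :: "'a \<Rightarrow> nat \<Rightarrow> 'a pc_monomial" is "\<lambda>a i. [(a, i)]" .

lift_definition pc_degree :: "'a pc_monomial \<Rightarrow> nat" is length
  by (metis equivclp_pc_swap_mset size_mset)

lift_definition pc_vars :: "'a pc_monomial \<Rightarrow> ('a \<times> nat) set" is set
  by (metis equivclp_pc_swap_mset set_mset_mset)

text \<open>
  A monomial has only finitely many factorizations, so that the convolution sum below is a
  finite sum.
\<close>

lemma finite_pc_factorizations: "finite {(u, v). u * v = (m :: 'a pc_monomial)}"
proof -
  obtain w where w: "m = abs_pc_monomial w"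
    by (metis Quotient3_abs_rep Quotient3_pc_monomial)
  define L where "L = {u. set u \<subseteq> set w \<and> length u \<le> length w}"
  have "finite L"
    unfolding L_def by (rule finite_lists_length_le) simp
  moreover have "{(u, v). u * v = m} \<subseteq> (\<lambda>(u, v). (abs_pc_monomial u, abs_pc_monomial v)) ` (L \<times> L)"
  proof clarify
    fix u v :: "'a pc_monomial"
    assume uv: "m = u * v"
    obtain u' v' where u': "u = abs_pc_monomial u'" and v': "v = abs_pc_monomial v'"
      by (metis Quotient3_abs_rep Quotient3_pc_monomial)
    have "equivclp pc_swap (u' @ v') w"
      using uv unfolding u' v' w times_pc_monomial.abs_eq
      by (metis pc_monomial.abs_eq_iff)
    then have "mset (u' @ v') = mset w"
      by (rule equivclp_pc_swap_mset)
    then have "set (u' @ v') = set w" "length (u' @ v') = length w"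
      by (metis set_mset_mset, metis size_mset)
    then have "u' \<in> L" "v' \<in> L"
      by (auto simp: L_def)
    then show "(u, v) \<in> (\<lambda>(u, v). (abs_pc_monomial u, abs_pc_monomial v)) ` (L \<times> L)"
      using u' v' by force
  qed
  ultimately show ?thesis
    by (meson finite_SigmaI finite_imageI finite_subset)
qed


section \<open>Series in partially commutative variables\<close>

definition pc_series :: "'a set \<Rightarrow> ('k::field, 'a pc_monomial \<Rightarrow> 'k) module" where
  "pc_series A = \<lparr>
     carrier = {f. (\<forall>m. f m \<noteq> 0 \<longrightarrow> pc_vars m \<subseteq> A \<times> {1..}) \<and>
                   (\<exists>d. \<forall>m. f m \<noteq> 0 \<longrightarrow> pc_degree m \<le> d)},
     monoid.mult = (\<lambda>f g m. \<Sum>(u, v) | u * v = m. f u * g v),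
     one = (\<lambda>m. if m = 1 then 1 else 0),
     zero = (\<lambda>m. 0),
     add = (\<lambda>f g m. f m + g m),
     smult = (\<lambda>c f m. c * f m)\<rparr>"

definition pc_word :: "'a list \<Rightarrow> nat \<Rightarrow> 'a pc_monomial" where
  "pc_word w j = prod_list (map (\<lambda>a. pc_var a j) w)"

definition pc_sentence :: "'a sentence \<Rightarrow> nat list \<Rightarrow> 'a pc_monomial" where
  "pc_sentence I js = prod_list (map2 pc_word I js)"

definition index_seqs :: "nat \<Rightarrow> nat list set" where
  "index_seqs n = {js. length js = n \<and> sorted_wrt (<) js \<and> (\<forall>j\<in>set js. 1 \<le> j)}"

text \<open>
  The coefficient of a monomial in the formal infinite sum \<open>M\<^sub>I\<close> is the number of summands
  equal to this monomial; this number is finite by the lemma \<open>finite_M_summands\<close>.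
\<close>

definition M_series :: "'a sentence \<Rightarrow> 'a pc_monomial \<Rightarrow> 'k::field" where
  "M_series I = (\<lambda>m. of_nat (card {js \<in> index_seqs (length I). pc_sentence I js = m}))"

lemma pc_vars_mult: "pc_vars (u * v) = pc_vars u \<union> pc_vars v"
  by transfer simp

lemma pc_vars_one: "pc_vars 1 = {}"
  by transfer simp

lemma pc_vars_var: "pc_vars (pc_var a i) = {(a, i)}"
  by transfer simp

lemma pc_vars_word: "pc_vars (pc_word w j) = set w \<times> {j}"
  by (induction w) (auto simp: pc_word_def pc_vars_mult pc_vars_one pc_vars_var)

lemma finite_pc_vars: "finite (pc_vars m)"
  by transfer simp

lemma index_in_pc_vars:
  "\<lbrakk>length js = length I; [] \<notin> set I\<rbrakk> \<Longrightarrow> set js \<subseteq> snd ` pc_vars (pc_sentence I js)"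
proof (induction js I rule: list_induct2)
  case (Cons j js w I)
  then show ?case
    by (cases w) (auto simp: pc_sentence_def pc_vars_mult pc_vars_word)
qed simp

lemma finite_M_summands:
  assumes "I \<in> sentences A"
  shows "finite {js \<in> index_seqs (length I). pc_sentence I js = m}"
proof (rule finite_subset)
  have "[] \<notin> set I"
    using assms by (auto simp: sentences_def)
  then show "{js \<in> index_seqs (length I). pc_sentence I js = m}
      \<subseteq> {js. set js \<subseteq> snd ` pc_vars m \<and> length js = length I}"
    using index_in_pc_vars by (auto simp: index_seqs_def)
  show "finite {js. set js \<subseteq> snd ` pc_vars m \<and> length js = length I}"
    by (rule finite_lists_length_eq) (simp add: finite_pc_vars)
qed

definition QSym :: "'a set \<Rightarrow> ('a pc_monomial \<Rightarrow> 'k::field) set" where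
  "QSym A = Modules.module.span (\<lambda>c f m. c * f m) (M_series ` sentences A)"

end

theory Submission
  imports Defs
begin

text \<open>
  A monomial in the partially commutative variables is determined by the words formed by its
  letters of each fixed index, and these words multiply by concatenation. Reading the
  non-empty ones in increasing order of the index attaches a sentence to every monomial, and
  \<open>M\<^sub>I\<close> is the sum of all monomials whose sentence is \<open>I\<close>. A factorization of a monomial with
  sentence \<open>I\<close> cuts each word of \<open>I\<close> into a prefix and a suffix, so it is the same as a
  subsentence \<open>J \<subset> I\<close>, and its two factors have the sentences obtained from \<open>I \<setminus> J\<close> and \<open>J\<close> by
  deleting empty words. Hence multiplication of series is given on coefficients by the same
  convolution that is dual to the coproduct of the \<open>H\<^sub>I\<close>.
\<close>

section \<open>Normal form of partially commutative monomials\<close>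

text \<open>A swap exchanges neighbours of different indices, and the filter for one index keeps at
  most one of them, so the word is constant on congruence classes.\<close>

lift_definition pc_proj :: "'a pc_monomial \<Rightarrow> nat \<Rightarrow> 'a list" is
  "\<lambda>w i. map fst (filter (\<lambda>x. snd x = i) w)"
proof -
  fix u v :: "('a \<times> nat) list"
  assume "equivclp pc_swap u v"
  then show "(\<lambda>i. map fst (filter (\<lambda>x. snd x = i) u)) = (\<lambda>i. map fst (filter (\<lambda>x. snd x = i) v))"
    by (induction rule: equivclp_induct) (auto elim!: pc_swap.cases simp: fun_eq_iff)
qed

lemma pc_proj_one: "pc_proj 1 i = []"
  by transfer simp

lemma pc_proj_mult: "pc_proj (u * v) i = pc_proj u i @ pc_proj v i"
  by transfer simp

lemma pc_proj_var: "pc_proj (pc_var a i) j = (if i = j then [a] else [])"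
  by transfer simp

text \<open>The letter \<open>x\<close> travels left past \<open>u\<close> one swap at a time; each
  swap is legal because the indices differ.\<close>

lemma equivclp_pc_swap_move_front:
  "\<forall>y\<in>set u. snd y \<noteq> snd x \<Longrightarrow> equivclp pc_swap (u @ x # v) (x # u @ v)"
proof (induction u)
  case Nil
  then show ?case by simp
next
  case (Cons y u)
  have "equivclp pc_swap (y # u @ x # v) (y # x # u @ v)"
    using Cons equivclp_pc_swap_append[of "u @ x # v" "x # u @ v" "[y]" "[]"] by simp
  moreover have "pc_swap (y # x # u @ v) (x # y # u @ v)"
    using Cons.prems pc_swap.intros[of "snd y" "snd x" "[]" "fst y" "fst x" "u @ v"] by simp
  ultimately show ?case
    by (metis append_Cons equivclp_into_equivclp)
qed

text \<open>The letters kept by the filter all have index \<open>i\<close>, so forgetting the index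
  loses nothing.\<close>

lemma map_fst_filter_snd_eq_iff:
  "map fst (filter (\<lambda>x. snd x = i) u) = map fst (filter (\<lambda>x. snd x = i) v) \<longleftrightarrow>
   filter (\<lambda>x. snd x = i) u = filter (\<lambda>x. snd x = i) v"
proof
  assume *: "map fst (filter (\<lambda>x. snd x = i) u) = map fst (filter (\<lambda>x. snd x = i) v)"
  have "filter (\<lambda>x. snd x = i) w = map (\<lambda>a. (a, i)) (map fst (filter (\<lambda>x. snd x = i) w))" for w :: "('a \<times> 'b) list"
    by (induction w) auto
  with * show "filter (\<lambda>x. snd x = i) u = filter (\<lambda>x. snd x = i) v"
    by metis
qed simp

text \<open>The first letter \<open>x\<close> of the left word is also the first letter of its index
  in \<open>v\<close>. Only letters of other indices precede it there, so it can be moved to the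
  front and split off; the remaining words agree under every filter again.\<close>

lemma equivclp_pc_swap_if_filter_eq:
  "(\<And>i. filter (\<lambda>x. snd x = i) u = filter (\<lambda>x. snd x = i) v) \<Longrightarrow> equivclp pc_swap u v"
proof (induction u arbitrary: v)
  case Nil
  then have "v = []"
    by (metis (mono_tags) filter.simps(1) filter_empty_conv list.set_intros(1) neq_Nil_conv)
  then show ?case by simp
next
  case (Cons x u)
  obtain v1 v2 where v: "v = v1 @ x # v2" "\<forall>y\<in>set v1. snd y \<noteq> snd x"
    and eq: "filter (\<lambda>y. snd y = snd x) u = filter (\<lambda>y. snd y = snd x) v2"
    using Cons.prems[of "snd x"] by (auto simp: Cons_eq_filter_iff)
  have "filter (\<lambda>y. snd y = i) u = filter (\<lambda>y. snd y = i) (v1 @ v2)" for i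
  proof (cases "i = snd x")
    case True
    then show ?thesis using eq v(2) by simp
  next
    case False
    then show ?thesis using Cons.prems[of i] v(1) by auto
  qed
  then have "equivclp pc_swap u (v1 @ v2)"
    by (rule Cons.IH)
  then have "equivclp pc_swap (x # u) (x # v1 @ v2)"
    using equivclp_pc_swap_append[of u "v1 @ v2" "[x]" "[]"] by simp
  with equivclp_pc_swap_move_front[OF v(2), of v2] show ?case
    unfolding v(1) by (meson equivclp_sym equivclp_trans)
qed

text \<open>With \<open>pc_proj_mult\<close>, this embeds the monomials into a product of free
  monoids, one for each index, so that equations between monomials can be checked index by
  index.\<close>

lemma pc_proj_inject: "(\<And>i. pc_proj u i = pc_proj v i) \<Longrightarrow> u = v"
  by transfer (rule equivclp_pc_swap_if_filter_eq, simp add: map_fst_filter_snd_eq_iff)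

lemma pc_vars_eq: "pc_vars m = {(a, i). a \<in> set (pc_proj m i)}"
  by transfer force

lemma pc_degree_one: "pc_degree 1 = 0"
  by transfer simp

lemma pc_degree_mult: "pc_degree (u * v) = pc_degree u + pc_degree v"
  by transfer simp

lemma pc_degree_var: "pc_degree (pc_var a i) = 1"
  by transfer simp

lemma pc_proj_word: "pc_proj (pc_word w j) i = (if i = j then w else [])"
  by (induction w) (auto simp: pc_word_def pc_proj_one pc_proj_mult pc_proj_var)

lemma pc_degree_word: "pc_degree (pc_word w j) = length w"
  by (induction w) (auto simp: pc_word_def pc_degree_one pc_degree_mult pc_degree_var)

lemma pc_degree_sentence:
  "length I = length js \<Longrightarrow> pc_degree (pc_sentence I js) = letters I"
  by (induction I js rule: list_induct2)
    (auto simp: pc_sentence_def letters_def pc_degree_one pc_degree_mult pc_degree_word)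

lemma pc_proj_sentence_outside:
  "\<lbrakk>length I = length js; i \<notin> set js\<rbrakk> \<Longrightarrow> pc_proj (pc_sentence I js) i = []"
  by (induction I js rule: list_induct2)
    (auto simp: pc_sentence_def pc_proj_one pc_proj_mult pc_proj_word)

text \<open>Distinct indices keep the words apart, each index seeing only its own factor. Words may
  be empty, as they can be in a subsentence.\<close>

lemma map_pc_proj_sentence:
  "\<lbrakk>length I = length js; distinct js\<rbrakk> \<Longrightarrow> map (pc_proj (pc_sentence I js)) js = I"
proof (induction I js rule: list_induct2)
  case (Cons w I j js)
  have split: "pc_sentence (w # I) (j # js) = pc_word w j * pc_sentence I js"
    by (simp add: pc_sentence_def)
  have "map (pc_proj (pc_sentence (w # I) (j # js))) js = map (pc_proj (pc_sentence I js)) js"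
    using Cons.prems by (auto simp: split pc_proj_mult pc_proj_word)
  also have "\<dots> = I"
    using Cons by simp
  finally have "map (pc_proj (pc_sentence (w # I) (j # js))) js = I" .
  moreover have "pc_proj (pc_sentence (w # I) (j # js)) j = w"
    using Cons pc_proj_sentence_outside[of I js j] by (simp add: split pc_proj_mult pc_proj_word)
  ultimately show ?case
    by simp
qed simp

section \<open>The sentence of a monomial\<close>

text \<open>Index 0 may occur in a \<open>pc_monomial\<close>, although the series avoid it; hence
  the condition \<open>0 \<notin> pc_indices m\<close> below.\<close>

definition pc_indices :: "'a pc_monomial \<Rightarrow> nat set" where
  "pc_indices m = {i. pc_proj m i \<noteq> []}"

definition pc_index_list :: "'a pc_monomial \<Rightarrow> nat list" where
  "pc_index_list m = sorted_list_of_set (pc_indices m)"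

definition pc_composition :: "'a pc_monomial \<Rightarrow> 'a sentence" where
  "pc_composition m = map (pc_proj m) (pc_index_list m)"

lemma finite_pc_indices: "finite (pc_indices m)"
proof -
  have "pc_indices m = snd ` pc_vars m"
    by (force simp: pc_indices_def pc_vars_eq image_iff intro: list.set_sel(1))
  then show ?thesis
    by (simp add: finite_pc_vars)
qed

lemma pc_indices_mult: "pc_indices (u * v) = pc_indices u \<union> pc_indices v"
  by (auto simp: pc_indices_def pc_proj_mult)

lemma set_pc_index_list: "set (pc_index_list m) = pc_indices m"
  by (simp add: pc_index_list_def finite_pc_indices)

lemma strict_sorted_pc_index_list: "sorted_wrt (<) (pc_index_list m)"
  by (simp add: pc_index_list_def)

lemma distinct_pc_index_list: "distinct (pc_index_list m)"
  by (simp add: pc_index_list_def)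

lemma length_pc_composition: "length (pc_composition m) = length (pc_index_list m)"
  by (simp add: pc_composition_def)

lemma Nil_notin_pc_composition: "[] \<notin> set (pc_composition m)"
  by (auto simp: pc_composition_def set_pc_index_list pc_indices_def)

text \<open>Indices in \<open>js\<close> that are missing from \<open>m\<close> contribute an empty
  word, hence the factor 1. This lets a factor of a monomial be rebuilt along the index list of the
  product.\<close>

lemma pc_sentence_map_pc_proj:
  assumes "distinct js" "pc_indices m \<subseteq> set js"
  shows "pc_sentence (map (pc_proj m) js) js = m"
proof (rule pc_proj_inject)
  fix i
  show "pc_proj (pc_sentence (map (pc_proj m) js) js) i = pc_proj m i"
  proof (cases "i \<in> set js")
    case True
    then show ?thesis
      using map_pc_proj_sentence[of "map (pc_proj m) js" js] assms(1) by (simp add: map_eq_conv)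
  next
    case False
    then have "pc_proj m i = []"
      using assms(2) by (auto simp: pc_indices_def)
    with False show ?thesis by (simp add: pc_proj_sentence_outside)
  qed
qed

lemma pc_sentence_pc_composition: "pc_sentence (pc_composition m) (pc_index_list m) = m"
  unfolding pc_composition_def
  by (rule pc_sentence_map_pc_proj) (simp_all add: distinct_pc_index_list set_pc_index_list)

lemma pc_degree_eq_letters: "pc_degree m = letters (pc_composition m)"
  using pc_degree_sentence[OF length_pc_composition, of m] by (simp add: pc_sentence_pc_composition)

text \<open>An index in \<open>js\<close> yields an empty word exactly when it does not occur in
  \<open>m\<close>. Dropping these leaves a strictly sorted list with the set
  \<open>pc_indices m\<close>, and such a list is unique.\<close>

lemma tilde_map_pc_proj:
  assumes "sorted_wrt (<) js" "pc_indices m \<subseteq> set js"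
  shows "tilde (map (pc_proj m) js) = pc_composition m"
proof -
  have "filter (\<lambda>i. pc_proj m i \<noteq> []) js = pc_index_list m"
    using assms
    by (intro strict_sorted_equal)
      (auto simp: sorted_wrt_filter strict_sorted_pc_index_list set_pc_index_list pc_indices_def)
  then show ?thesis
    by (simp add: tilde_def pc_composition_def filter_map comp_def)
qed

text \<open>Since no word of \<open>I\<close> is empty, every index in \<open>js\<close> really
  occurs in the monomial, and a strictly sorted list is determined by its set.\<close>

lemma pc_index_list_sentence:
  assumes "length I = length js" "sorted_wrt (<) js" "[] \<notin> set I"
  shows "pc_index_list (pc_sentence I js) = js"
proof (rule strict_sorted_equal)
  have "map (pc_proj (pc_sentence I js)) js = I"
    using assms(1,2) strict_sorted_iff by (blast intro: map_pc_proj_sentence)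
  then have "pc_proj (pc_sentence I js) i \<in> set I" if "i \<in> set js" for i
    using that by (metis imageI list.set_map)
  then show "set (pc_index_list (pc_sentence I js)) = set js"
    using assms(1,3) pc_proj_sentence_outside[OF assms(1)]
    by (force simp: set_pc_index_list pc_indices_def)
qed (use assms strict_sorted_pc_index_list in auto)

lemma pc_composition_sentence:
  assumes "length I = length js" "sorted_wrt (<) js" "[] \<notin> set I"
  shows "pc_composition (pc_sentence I js) = I"
  unfolding pc_composition_def pc_index_list_sentence[OF assms]
  using assms strict_sorted_iff by (intro map_pc_proj_sentence) blast+

text \<open>The index sequence of a summand can be recovered from the monomial as its index list, so
  each monomial occurs at most once. Index 0 is excluded because index sequences start at 1 or
  later.\<close>

lemma M_series_eq:
  assumes "I \<in> sentences A"
  shows "M_series I m = (if pc_composition m = I \<and> 0 \<notin> pc_indices m then 1 else 0)"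
proof -
  have ne: "[] \<notin> set I"
    using assms by (auto simp: sentences_def)
  have "{js \<in> index_seqs (length I). pc_sentence I js = m}
      = (if pc_composition m = I \<and> 0 \<notin> pc_indices m then {pc_index_list m} else {})"
  proof (cases "pc_composition m = I \<and> 0 \<notin> pc_indices m")
    case True
    have "pc_index_list m \<in> index_seqs (length I)"
      using True strict_sorted_pc_index_list[of m] length_pc_composition[of m]
      by (auto simp: index_seqs_def set_pc_index_list Suc_le_eq intro: gr0I)
    moreover have "pc_sentence I (pc_index_list m) = m"
      using True pc_sentence_pc_composition by metis
    moreover have "js = pc_index_list m" if "js \<in> index_seqs (length I)" "pc_sentence I js = m" for js
      using that pc_index_list_sentence[of I js] ne by (auto simp: index_seqs_def)
    ultimately have "{js \<in> index_seqs (length I). pc_sentence I js = m} = {pc_index_list m}"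
      by blast
    with True show ?thesis by presburger
  next
    case False
    have "pc_composition m = I \<and> 0 \<notin> pc_indices m"
      if "js \<in> index_seqs (length I)" "pc_sentence I js = m" for js
    proof -
      have "length I = length js" "sorted_wrt (<) js" "0 \<notin> set js"
        using that(1) by (auto simp: index_seqs_def)
      with ne that(2) show ?thesis
        using pc_composition_sentence pc_index_list_sentence set_pc_index_list by metis
    qed
    with False have "{js \<in> index_seqs (length I). pc_sentence I js = m} = {}"
      by blast
    with False show ?thesis by presburger
  qed
  then show ?thesis
    by (simp add: M_series_def)
qed

section \<open>Factorizations of a monomial\<close>

lemma length_subsentences: "J \<in> subsentences I \<Longrightarrow> length J = length I"
  by (auto simp: subsentences_def dest: list_all2_lengthD)

lemma length_sminus: "J \<in> subsentences I \<Longrightarrow> length (sminus I J) = length I"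
  by (simp add: sminus_def length_subsentences)

lemma map2_append_sminus:
  assumes "J \<in> subsentences I"
  shows "map2 (@) (sminus I J) J = I"
proof -
  have "list_all2 suffix J I"
    using assms by (simp add: subsentences_def)
  then show ?thesis
    by (induction rule: list_all2_induct) (auto simp: sminus_def suffix_def)
qed

lemma letters_tilde: "letters (tilde I) = letters I"
  by (induction I) (auto simp: letters_def tilde_def)

lemma letters_sminus:
  assumes "J \<in> subsentences I"
  shows "letters I = letters (sminus I J) + letters J"
proof -
  have "list_all2 suffix J I"
    using assms by (simp add: subsentences_def)
  then show ?thesis
    by (induction rule: list_all2_induct) (auto simp: sminus_def suffix_def letters_def)
qed

lemma tilde_in_sentences_iff: "tilde I \<in> sentences A \<longleftrightarrow> I \<in> lists (lists A)"
  by (induction I) (auto simp: tilde_def sentences_def)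

lemma sentence_of_parts:
  assumes "J \<in> subsentences I" "sminus I J \<in> lists (lists A)" "J \<in> lists (lists A)"
  shows "I \<in> lists (lists A)"
proof -
  have "list_all2 suffix J I"
    using assms by (simp add: subsentences_def)
  then show ?thesis
    using assms(2,3) by (induction rule: list_all2_induct) (auto simp: sminus_def suffix_def)
qed

text \<open>At each index the right factor \<open>v\<close> carries a suffix of the word of
  \<open>m\<close>. It is read along the index list of \<open>m\<close>, not its own, so that empty
  suffixes are kept and the list is aligned with \<open>pc_composition m\<close>.\<close>

lemma bij_betw_factorizations:
  "bij_betw (\<lambda>(u, v). map (pc_proj v) (pc_index_list m)) {(u, v). u * v = m}
     (subsentences (pc_composition m))"
proof (rule bij_betwI')
  fix p q assume p: "p \<in> {(u, v). u * v = m}" and q: "q \<in> {(u, v). u * v = m}"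
  obtain u v where uv: "p = (u, v)" "u * v = m" using p by auto
  obtain u' v' where uv': "q = (u', v')" "u' * v' = m" using q by auto
  have "p = q" if eq: "map (pc_proj v) (pc_index_list m) = map (pc_proj v') (pc_index_list m)"
  proof -
    \<comment> \<open>All indices of a factor lie among those of \<open>m\<close>, so both right
      factors can be rebuilt from the same list of words.\<close>
    have "v = v'"
      using eq distinct_pc_index_list[of m] set_pc_index_list[of m] uv(2) uv'(2) pc_indices_mult
      by (metis pc_sentence_map_pc_proj sup_ge2)
    moreover have "u = u'"
    proof (rule pc_proj_inject)
      show "pc_proj u i = pc_proj u' i" for i
        using uv(2) uv'(2) \<open>v = v'\<close> pc_proj_mult[of u v i] pc_proj_mult[of u' v' i] by simp
    qed
    ultimately show ?thesis by (simp add: uv(1) uv'(1))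
  qed
  then show "((case p of (u, v) \<Rightarrow> map (pc_proj v) (pc_index_list m))
      = (case q of (u, v) \<Rightarrow> map (pc_proj v) (pc_index_list m))) = (p = q)"
    by (auto simp: uv(1) uv'(1))
next
  fix p assume "p \<in> {(u, v). u * v = m}"
  then show "(case p of (u, v) \<Rightarrow> map (pc_proj v) (pc_index_list m)) \<in> subsentences (pc_composition m)"
    by (auto simp: subsentences_def pc_composition_def list.rel_map pc_proj_mult
        intro!: list.rel_refl_strong suffixI)
next
  fix J assume J: "J \<in> subsentences (pc_composition m)"
  let ?js = "pc_index_list m"
  \<comment> \<open>The inverse map puts the prefixes and the suffixes back at the indices of
    \<open>m\<close>.\<close>
  define u where "u = pc_sentence (sminus (pc_composition m) J) ?js"
  define v where "v = pc_sentence J ?js"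
  have len: "length (sminus (pc_composition m) J) = length ?js" "length J = length ?js"
    using J by (simp_all add: length_sminus length_subsentences length_pc_composition)
  have pu: "map (pc_proj u) ?js = sminus (pc_composition m) J" and pv: "map (pc_proj v) ?js = J"
    by (simp_all add: u_def v_def len map_pc_proj_sentence distinct_pc_index_list)
  have "map2 (@) (map (pc_proj u) ?js) (map (pc_proj v) ?js) = map (pc_proj m) ?js"
    using map2_append_sminus[OF J] unfolding pu pv by (simp add: pc_composition_def)
  then have "map (\<lambda>i. pc_proj u i @ pc_proj v i) ?js = map (pc_proj m) ?js"
    by (simp add: zip_map_map zip_same_conv_map comp_def)
  then have inside: "pc_proj u i @ pc_proj v i = pc_proj m i" if "i \<in> set ?js" for i
    using that by simp
  have "u * v = m"
  proof (rule pc_proj_inject)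
    fix i
    show "pc_proj (u * v) i = pc_proj m i"
    proof (cases "i \<in> set ?js")
      case True
      then show ?thesis by (simp add: pc_proj_mult inside)
    next
      case False
      moreover have "pc_proj m i = []"
        using False by (simp add: set_pc_index_list pc_indices_def)
      ultimately show ?thesis
        by (simp add: pc_proj_mult u_def v_def pc_proj_sentence_outside len)
    qed
  qed
  then show "\<exists>p\<in>{(u, v). u * v = m}. J = (case p of (u, v) \<Rightarrow> map (pc_proj v) ?js)"
    using pv by auto
qed

text \<open>This matches a factorization with the coproduct term of its subsentence: the index list
  of \<open>m\<close> covers both factors, so \<open>tilde_map_pc_proj\<close> applies to
  each.\<close>

lemma factorization_parts:
  assumes "u * v = m"
  defines "J \<equiv> map (pc_proj v) (pc_index_list m)"
  shows "tilde J = pc_composition v" "tilde (sminus (pc_composition m) J) = pc_composition u"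
proof -
  have sub: "pc_indices u \<subseteq> set (pc_index_list m)" "pc_indices v \<subseteq> set (pc_index_list m)"
    using assms(1) by (auto simp: set_pc_index_list pc_indices_mult)
  show "tilde J = pc_composition v"
    unfolding J_def by (rule tilde_map_pc_proj[OF strict_sorted_pc_index_list sub(2)])
  \<comment> \<open>At every index the word of \<open>m\<close> is that of \<open>u\<close> followed
    by that of \<open>v\<close>; cutting off the suffix leaves the word of \<open>u\<close>.\<close>
  have "sminus (pc_composition m) J = map (pc_proj u) (pc_index_list m)"
    by (simp add: sminus_def J_def pc_composition_def zip_map_map zip_same_conv_map comp_def
        flip: assms(1) pc_proj_mult)
      (simp add: pc_proj_mult)
  then show "tilde (sminus (pc_composition m) J) = pc_composition u"
    using tilde_map_pc_proj[OF strict_sorted_pc_index_list sub(1)] by simp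
qed

section \<open>Families of coefficients\<close>

text \<open>These are the common coordinates of both algebras. The bound on \<open>letters\<close>
  corresponds to bounded degree of series and to the finiteness condition in the graded dual; for
  finite \<open>A\<close> it forces finite support.\<close>

definition coeff_families :: "'a set \<Rightarrow> ('a sentence \<Rightarrow> 'k::field) set" where
  "coeff_families A = {c. (\<forall>I. c I \<noteq> 0 \<longrightarrow> I \<in> sentences A) \<and> (\<exists>d. \<forall>I. c I \<noteq> 0 \<longrightarrow> letters I \<le> d)}"

definition coeff_unit :: "'a sentence \<Rightarrow> 'a sentence \<Rightarrow> 'k::field" where
  "coeff_unit I = (\<lambda>J. if J = I then 1 else 0)"

text \<open>
  Lists containing an empty word are not sentences, but the sum below need not vanish on them.
\<close>

definition convolution ::
    "('a sentence \<Rightarrow> 'k::field) \<Rightarrow> ('a sentence \<Rightarrow> 'k) \<Rightarrow> 'a sentence \<Rightarrow> 'k" where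
  "convolution c d I = (if [] \<in> set I then 0
     else \<Sum>J\<in>subsentences I. c (tilde (sminus I J)) * d (tilde J))"

text \<open>For \<open>c\<close> in \<open>coeff_families A\<close> this is the combination of the
  \<open>M_series I\<close> with coefficients \<open>c I\<close>: a monomial occurs in at most one
  of them, so a single coefficient is read.\<close>

definition series_of :: "('a sentence \<Rightarrow> 'k::field) \<Rightarrow> 'a pc_monomial \<Rightarrow> 'k" where
  "series_of c m = (if 0 \<in> pc_indices m then 0 else c (pc_composition m))"

definition functional_of ::
    "'a set \<Rightarrow> ('a sentence \<Rightarrow> 'k::field) \<Rightarrow> ('a sentence \<Rightarrow>\<^sub>0 'k) \<Rightarrow> 'k" where
  "functional_of A c p =
     (if p \<in> nsym A then \<Sum>I\<in>Poly_Mapping.keys p. Poly_Mapping.lookup p I * c I else 0)"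

lemma sentences_iff: "I \<in> sentences A \<longleftrightarrow> I \<in> lists (lists A) \<and> [] \<notin> set I"
  by (auto simp: sentences_def)

lemma coeff_family_eq_zero: "c \<in> coeff_families A \<Longrightarrow> I \<notin> sentences A \<Longrightarrow> c I = 0"
  by (auto simp: coeff_families_def)

lemma coeff_unit_in: "I \<in> sentences A \<Longrightarrow> coeff_unit I \<in> coeff_families A"
  by (auto simp: coeff_families_def coeff_unit_def)

lemma zero_in_coeff_families: "(\<lambda>I. 0) \<in> coeff_families A"
  by (auto simp: coeff_families_def)

lemma add_in_coeff_families:
  assumes "c \<in> coeff_families A" "d \<in> coeff_families A"
  shows "(\<lambda>I. c I + d I) \<in> coeff_families A"
proof -
  obtain m n where "\<forall>I. c I \<noteq> 0 \<longrightarrow> letters I \<le> m" "\<forall>I. d I \<noteq> 0 \<longrightarrow> letters I \<le> n"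
    using assms by (auto simp: coeff_families_def)
  then have "\<forall>I. c I + d I \<noteq> 0 \<longrightarrow> letters I \<le> max m n"
    by (metis add.right_neutral le_max_iff_disj)
  moreover have "\<forall>I. c I + d I \<noteq> 0 \<longrightarrow> I \<in> sentences A"
    using assms by (metis add.right_neutral coeff_family_eq_zero)
  ultimately show ?thesis
    by (auto simp: coeff_families_def)
qed

lemma scale_in_coeff_families:
  "c \<in> coeff_families A \<Longrightarrow> (\<lambda>I. k * c I) \<in> coeff_families A"
  by (auto simp: coeff_families_def)

text \<open>A non-zero value has a non-zero summand. Both parts of that cut are then sentences over
  \<open>A\<close>, and their numbers of letters add up, so the two bounds add up as well.\<close>

lemma convolution_in_coeff_families:
  assumes "c \<in> coeff_families A" "d \<in> coeff_families A"
  shows "convolution c d \<in> coeff_families A"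
proof -
  obtain m n where mn: "\<forall>I. c I \<noteq> 0 \<longrightarrow> letters I \<le> m" "\<forall>I. d I \<noteq> 0 \<longrightarrow> letters I \<le> n"
    using assms by (auto simp: coeff_families_def)
  have "I \<in> sentences A \<and> letters I \<le> m + n" if "convolution c d I \<noteq> 0" for I
  proof -
    have ne: "[] \<notin> set I"
      and "(\<Sum>J\<in>subsentences I. c (tilde (sminus I J)) * d (tilde J)) \<noteq> 0"
      using that by (auto simp: convolution_def split: if_splits)
    then obtain J where J: "J \<in> subsentences I" and nz: "c (tilde (sminus I J)) * d (tilde J) \<noteq> 0"
      by (meson sum.not_neutral_contains_not_neutral)
    have "c (tilde (sminus I J)) \<noteq> 0" "d (tilde J) \<noteq> 0"
      using nz by auto
    then have "tilde (sminus I J) \<in> sentences A" "tilde J \<in> sentences A"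
        "letters (sminus I J) \<le> m" "letters J \<le> n"
      using assms mn by (auto simp: coeff_families_def) (metis letters_tilde)+
    then show ?thesis
      using sentence_of_parts[OF J, of A] letters_sminus[OF J] ne
      by (simp only: tilde_in_sentences_iff sentences_iff[of I]) simp
  qed
  then show ?thesis
    unfolding coeff_families_def by blast
qed

section \<open>Quasisymmetric series\<close>

lemma pc_composition_eq_Nil_iff: "pc_composition m = [] \<longleftrightarrow> m = 1"
proof
  assume "pc_composition m = []"
  then have "pc_indices m = {}"
    using set_pc_index_list[of m] length_pc_composition[of m] by auto
  then show "m = 1"
    by (intro pc_proj_inject) (simp add: pc_proj_one pc_indices_def)
next
  assume "m = 1"
  then have "pc_indices m = {}"
    by (simp add: pc_indices_def pc_proj_one)
  then show "pc_composition m = []"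
    by (simp add: pc_composition_def pc_index_list_def)
qed

text \<open>This turns the support condition in the carrier of \<open>pc_series\<close> into one on
  the sentence of the monomial.\<close>

lemma pc_vars_subset_iff:
  "pc_vars m \<subseteq> A \<times> {1..} \<longleftrightarrow> pc_composition m \<in> sentences A \<and> 0 \<notin> pc_indices m"
proof -
  have "pc_vars m \<subseteq> A \<times> {1..} \<longleftrightarrow> (\<forall>i\<in>pc_indices m. set (pc_proj m i) \<subseteq> A \<and> 1 \<le> i)"
  proof
    assume "pc_vars m \<subseteq> A \<times> {1..}"
    then have "a \<in> A \<and> 1 \<le> i" if "a \<in> set (pc_proj m i)" for a i
      using that by (auto simp: pc_vars_eq)
    \<comment> \<open>An occurring index has a non-empty word; its head gives a variable to which
      the bound on the index applies.\<close>
    moreover have "hd (pc_proj m i) \<in> set (pc_proj m i)" if "i \<in> pc_indices m" for i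
      using that by (simp add: pc_indices_def)
    ultimately show "\<forall>i\<in>pc_indices m. set (pc_proj m i) \<subseteq> A \<and> 1 \<le> i"
      by blast
  next
    assume *: "\<forall>i\<in>pc_indices m. set (pc_proj m i) \<subseteq> A \<and> 1 \<le> i"
    have "i \<in> pc_indices m" if "a \<in> set (pc_proj m i)" for a i
      using that by (auto simp: pc_indices_def)
    with * show "pc_vars m \<subseteq> A \<times> {1..}"
      by (auto simp: pc_vars_eq)
  qed
  also have "\<dots> \<longleftrightarrow> (\<forall>i\<in>pc_indices m. set (pc_proj m i) \<subseteq> A) \<and> 0 \<notin> pc_indices m"
    by (metis One_nat_def Suc_le_eq gr0I less_irrefl)
  finally show ?thesis
    using Nil_notin_pc_composition[of m]
    by (auto simp: sentences_iff pc_composition_def set_pc_index_list in_lists_conv_set)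
qed

lemma M_series_eq_series_of: "I \<in> sentences A \<Longrightarrow> M_series I = series_of (coeff_unit I)"
  by (simp add: fun_eq_iff M_series_eq series_of_def coeff_unit_def)

lemma series_of_inject:
  assumes "c \<in> coeff_families A" "d \<in> coeff_families A" "series_of c = series_of d"
  shows "c = d"
proof
  fix I
  show "c I = d I"
  proof (cases "I \<in> sentences A")
    case True
    \<comment> \<open>The indices 1 to \<open>length I\<close> realize \<open>I\<close> as the
      sentence of a monomial without index 0, at which both series show their coefficient at
      \<open>I\<close>.\<close>
    define js where "js = [1..<Suc (length I)]"
    define m where "m = pc_sentence I js"
    have js: "length I = length js"
      by (simp add: js_def del: upt_Suc)
    have sorted: "sorted_wrt (<) js"
      unfolding js_def by (rule sorted_wrt_upt)
    have ne: "[] \<notin> set I"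
      using True by (simp add: sentences_iff)
    have "pc_composition m = I"
      unfolding m_def using js sorted ne by (rule pc_composition_sentence)
    moreover have "pc_index_list m = js"
      unfolding m_def using js sorted ne by (rule pc_index_list_sentence)
    then have "0 \<notin> pc_indices m"
      by (simp add: js_def del: upt_Suc flip: set_pc_index_list)
    ultimately show ?thesis
      using fun_cong[OF assms(3), of m] by (simp add: series_of_def)
  qed (use assms in \<open>simp add: coeff_family_eq_zero\<close>)
qed

lemma series_of_in_carrier:
  assumes "c \<in> coeff_families A"
  shows "series_of c \<in> carrier (pc_series A)"
proof -
  obtain d where "\<forall>I. c I \<noteq> 0 \<longrightarrow> letters I \<le> d"
    using assms by (auto simp: coeff_families_def)
  then have "\<forall>m. series_of c m \<noteq> 0 \<longrightarrow> pc_degree m \<le> d"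
    by (simp add: series_of_def pc_degree_eq_letters)
  moreover have "\<forall>m. series_of c m \<noteq> 0 \<longrightarrow> pc_vars m \<subseteq> A \<times> {1..}"
    unfolding pc_vars_subset_iff using coeff_family_eq_zero[OF assms] by (auto simp: series_of_def)
  ultimately show ?thesis
    by (auto simp: pc_series_def)
qed

lemma series_of_one: "\<one>\<^bsub>pc_series A\<^esub> = series_of (coeff_unit [])"
  by (auto simp: pc_series_def series_of_def coeff_unit_def fun_eq_iff pc_composition_eq_Nil_iff
      pc_indices_def pc_proj_one)

lemma series_of_zero: "\<zero>\<^bsub>pc_series A\<^esub> = series_of (\<lambda>I. 0)"
  by (auto simp: pc_series_def series_of_def)

lemma series_of_add: "series_of c \<oplus>\<^bsub>pc_series A\<^esub> series_of d = series_of (\<lambda>I. c I + d I)"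
  by (auto simp: pc_series_def series_of_def)

lemma series_of_scale: "k \<odot>\<^bsub>pc_series A\<^esub> series_of c = series_of (\<lambda>I. k * c I)"
  by (auto simp: pc_series_def series_of_def)

lemma series_of_mult:
  fixes c d :: "'a sentence \<Rightarrow> 'k::field"
  shows "series_of c \<otimes>\<^bsub>pc_series A\<^esub> series_of d = series_of (convolution c d)"
proof
  fix m :: "'a pc_monomial"
  let ?J = "\<lambda>v. map (pc_proj v) (pc_index_list m)"
  have "(series_of c \<otimes>\<^bsub>pc_series A\<^esub> series_of d) m
      = (\<Sum>(u, v) | u * v = m. series_of c u * series_of d v)"
    by (simp add: pc_series_def)
  \<comment> \<open>Index 0 occurs in the product iff it occurs in one of the factors, so the test
    moves out to \<open>m\<close>.\<close>
  also have "\<dots> = (\<Sum>(u, v) | u * v = m. if 0 \<in> pc_indices m then 0 else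
      c (tilde (sminus (pc_composition m) (?J v))) * d (tilde (?J v)))"
  proof (rule sum.cong[OF refl], clarify)
    fix u v :: "'a pc_monomial"
    assume m: "m = u * v"
    show "series_of c u * series_of d v = (if 0 \<in> pc_indices (u * v) then 0 else
        c (tilde (sminus (pc_composition (u * v)) (map (pc_proj v) (pc_index_list (u * v)))))
        * d (tilde (map (pc_proj v) (pc_index_list (u * v)))))"
      by (simp add: factorization_parts[OF refl] series_of_def pc_indices_mult)
  qed
  \<comment> \<open>The summand now depends on the factorization only through its subsentence, which
    is the shape needed for reindexing.\<close>
  also have "\<dots> = (\<Sum>p | (case p of (u, v) \<Rightarrow> u * v = m).
      (\<lambda>J. if 0 \<in> pc_indices m then 0 else c (tilde (sminus (pc_composition m) J)) * d (tilde J))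
        (case p of (u, v) \<Rightarrow> ?J v))"
    by (intro sum.cong) auto
  also have "\<dots> = (\<Sum>J\<in>subsentences (pc_composition m). if 0 \<in> pc_indices m then 0 else
      c (tilde (sminus (pc_composition m) J)) * d (tilde J))"
    by (rule sum.reindex_bij_betw[OF bij_betw_factorizations])
  also have "\<dots> = series_of (convolution c d) m"
    by (simp add: series_of_def convolution_def Nil_notin_pc_composition)
  finally show "(series_of c \<otimes>\<^bsub>pc_series A\<^esub> series_of d) m = series_of (convolution c d) m" .
qed

section \<open>Finiteness over a finite alphabet, and the span of the monomial series\<close>

lemma finite_sentences_letters_le:
  assumes "finite A"
  shows "finite {I \<in> sentences A. letters I \<le> d}"
proof (rule finite_subset)
  define W where "W = {w. set w \<subseteq> A \<and> length w \<le> d}"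
  have "set I \<subseteq> W \<and> length I \<le> d" if I: "I \<in> sentences A" "letters I \<le> d" for I
  proof -
    have "length w \<le> d" if "w \<in> set I" for w
      using that I(2) member_le_sum_list[of "length w" "map length I"] by (simp add: letters_def)
    \<comment> \<open>Words of a sentence are non-empty, so each contributes at least one
      letter.\<close>
    moreover have "length I \<le> letters I"
    proof -
      have "sum_list (map (\<lambda>w. 1) I) \<le> sum_list (map length I)"
        using I(1) by (intro sum_list_mono) (auto simp: sentences_iff Suc_le_eq)
      then show ?thesis
        by (simp add: letters_def sum_list_triv)
    qed
    ultimately show ?thesis
      using I by (auto simp: W_def sentences_def)
  qed
  then show "{I \<in> sentences A. letters I \<le> d} \<subseteq> {I. set I \<subseteq> W \<and> length I \<le> d}"
    by auto
  show "finite {I. set I \<subseteq> W \<and> length I \<le> d}"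
    unfolding W_def by (intro finite_lists_length_le assms)
qed

lemma finite_support_coeff_family:
  assumes "finite A" "c \<in> coeff_families A"
  shows "finite {I. c I \<noteq> 0}"
proof -
  obtain d where "\<forall>I. c I \<noteq> 0 \<longrightarrow> letters I \<le> d"
    using assms(2) by (auto simp: coeff_families_def)
  then have "{I. c I \<noteq> 0} \<subseteq> {I \<in> sentences A. letters I \<le> d}"
    using assms(2) by (auto simp: coeff_families_def)
  then show ?thesis
    using finite_sentences_letters_le[OF assms(1)] finite_subset by blast
qed

lemma sum_fun_apply: "(\<Sum>x\<in>S. f x) y = (\<Sum>x\<in>S. f x y)"
  by (induction S rule: infinite_finite_induct) (auto simp: plus_fun_def zero_fun_def)

text \<open>The right side is a subspace containing the generators. Conversely, finite support turns
  \<open>series_of c\<close> into a finite combination of generators; this is where the finiteness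
  of \<open>A\<close> enters.\<close>

lemma QSym_eq:
  assumes "finite A"
  shows "(QSym A :: ('a pc_monomial \<Rightarrow> 'k::field) set) = series_of ` coeff_families A"
proof -
  interpret fm: Modules.module "\<lambda>(c::'k) (f :: 'a pc_monomial \<Rightarrow> 'k) m. c * f m"
    by standard (auto simp: fun_eq_iff plus_fun_def algebra_simps)
  show ?thesis
  proof
    have "fm.subspace (series_of ` coeff_families A)"
    proof (rule fm.subspaceI)
      show "0 \<in> series_of ` coeff_families A"
        by (rule image_eqI[OF _ zero_in_coeff_families]) (simp add: series_of_def fun_eq_iff)
    next
      fix f g :: "'a pc_monomial \<Rightarrow> 'k"
      assume "f \<in> series_of ` coeff_families A" "g \<in> series_of ` coeff_families A"
      then obtain c d where "f = series_of c" "g = series_of d" "c \<in> coeff_families A" "d \<in> coeff_families A"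
        by auto
      then show "f + g \<in> series_of ` coeff_families A"
        by (intro image_eqI[OF _ add_in_coeff_families[of c A d]]) (auto simp: series_of_def fun_eq_iff)
    next
      fix k and f :: "'a pc_monomial \<Rightarrow> 'k"
      assume "f \<in> series_of ` coeff_families A"
      then obtain c where "f = series_of c" "c \<in> coeff_families A"
        by auto
      then show "(\<lambda>m. k * f m) \<in> series_of ` coeff_families A"
        by (intro image_eqI[OF _ scale_in_coeff_families[of c A k]]) (auto simp: series_of_def fun_eq_iff)
    qed
    moreover have "M_series ` sentences A \<subseteq> series_of ` coeff_families A"
      using coeff_unit_in by (fastforce simp: M_series_eq_series_of)
    ultimately show "QSym A \<subseteq> (series_of ` coeff_families A :: ('a pc_monomial \<Rightarrow> 'k) set)"
      unfolding QSym_def by (intro fm.span_minimal)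
  next
    show "series_of ` coeff_families A \<subseteq> (QSym A :: ('a pc_monomial \<Rightarrow> 'k) set)"
    proof (rule image_subsetI)
      fix c :: "'a sentence \<Rightarrow> 'k"
      assume c: "c \<in> coeff_families A"
      let ?S = "{I. c I \<noteq> 0}"
      have "finite ?S"
        using assms c by (rule finite_support_coeff_family)
      \<comment> \<open>At a monomial \<open>m\<close> only the summand with
        \<open>I = pc_composition m\<close> can survive.\<close>
      then have "(\<Sum>I\<in>?S. (\<lambda>m. c I * series_of (coeff_unit I) m)) = series_of c"
        by (auto simp: fun_eq_iff sum_fun_apply series_of_def coeff_unit_def if_distrib cong: if_cong)
      moreover have "(\<Sum>I\<in>?S. (\<lambda>m. c I * series_of (coeff_unit I) m)) \<in> QSym A"
        unfolding QSym_def
      proof (intro fm.span_sum fm.span_scale fm.span_base)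
        fix I assume "I \<in> ?S"
        then have "I \<in> sentences A"
          using c by (auto simp: coeff_families_def)
        then show "series_of (coeff_unit I) \<in> M_series ` sentences A"
          by (metis M_series_eq_series_of imageI)
      qed
      ultimately show "series_of c \<in> QSym A"
        by simp
    qed
  qed
qed

lemma QSym_subalgebra:
  assumes "finite A"
  shows "is_subalgebra (QSym A) (pc_series A :: ('k::field, 'a pc_monomial \<Rightarrow> 'k) module)"
proof -
  let ?P = "pc_series A :: ('k, 'a pc_monomial \<Rightarrow> 'k) module"
  note Q = QSym_eq[OF assms, where 'k = 'k]
  have sub: "QSym A \<subseteq> carrier ?P"
    by (auto simp: Q series_of_in_carrier)
  have add: "x \<oplus>\<^bsub>?P\<^esub> y \<in> QSym A" if "x \<in> QSym A" "y \<in> QSym A" for x y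
    using that by (auto simp: Q series_of_add add_in_coeff_families)
  have mult: "x \<otimes>\<^bsub>?P\<^esub> y \<in> QSym A" if "x \<in> QSym A" "y \<in> QSym A" for x y
    using that by (auto simp: Q series_of_mult convolution_in_coeff_families)
  have scale: "k \<odot>\<^bsub>?P\<^esub> x \<in> QSym A" if "x \<in> QSym A" for k x
    using that by (auto simp: Q series_of_scale scale_in_coeff_families)
  have one: "\<one>\<^bsub>?P\<^esub> \<in> QSym A"
    by (auto simp: Q series_of_one sentences_def intro!: coeff_unit_in)
  have zero: "\<zero>\<^bsub>?P\<^esub> \<in> QSym A"
    by (auto simp: Q series_of_zero zero_in_coeff_families)
  \<comment> \<open>The inverse is a definite description over the carrier of
    \<open>pc_series A\<close>; it is evaluated directly as the pointwise negative.\<close>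
  have inv: "inv\<^bsub>add_monoid ?P\<^esub> x \<in> QSym A" if x: "x \<in> QSym A" for x
  proof -
    have neg: "(\<lambda>m. - x m) \<in> QSym A"
      using scale[OF x, of "- 1"] by (simp add: pc_series_def)
    have "inv\<^bsub>add_monoid ?P\<^esub> x = (\<lambda>m. - x m)"
      unfolding m_inv_def
    proof (rule the_equality)
      show "(\<lambda>m. - x m) \<in> carrier (add_monoid ?P) \<and>
          x \<otimes>\<^bsub>add_monoid ?P\<^esub> (\<lambda>m. - x m) = \<one>\<^bsub>add_monoid ?P\<^esub> \<and>
          (\<lambda>m. - x m) \<otimes>\<^bsub>add_monoid ?P\<^esub> x = \<one>\<^bsub>add_monoid ?P\<^esub>"
        using subsetD[OF sub neg] by (simp add: pc_series_def)
    next
      fix y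
      assume "y \<in> carrier (add_monoid ?P) \<and> x \<otimes>\<^bsub>add_monoid ?P\<^esub> y = \<one>\<^bsub>add_monoid ?P\<^esub> \<and>
          y \<otimes>\<^bsub>add_monoid ?P\<^esub> x = \<one>\<^bsub>add_monoid ?P\<^esub>"
      then have "\<forall>m. x m + y m = 0"
        by (simp add: pc_series_def fun_eq_iff)
      then show "y = (\<lambda>m. - x m)"
        by (simp add: fun_eq_iff eq_neg_iff_add_eq_0 add.commute)
    qed
    with neg show ?thesis by simp
  qed
  have "subring (QSym A) ?P"
    using sub add mult one zero inv by unfold_locales auto
  with scale show ?thesis
    by (simp add: is_subalgebra_def)
qed

section \<open>Functionals\<close>

lemma H_basis_in_nsym_iff: "(H_basis I :: 'a sentence \<Rightarrow>\<^sub>0 'k::field) \<in> nsym A \<longleftrightarrow> I \<in> sentences A"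
  by (simp add: H_basis_def nsym_def)

text \<open>Cancellation can shrink the keys of \<open>p + q\<close>. Summing over a larger set,
  where the extra coefficients are 0, puts \<open>p\<close>, \<open>q\<close> and
  \<open>p + q\<close> on a common index set.\<close>

lemma functional_of_superset:
  assumes "p \<in> nsym A" "finite K" "Poly_Mapping.keys p \<subseteq> K"
  shows "functional_of A c p = (\<Sum>I\<in>K. Poly_Mapping.lookup p I * c I)"
proof -
  have "functional_of A c p = (\<Sum>I\<in>Poly_Mapping.keys p. Poly_Mapping.lookup p I * c I)"
    using assms(1) by (simp add: functional_of_def)
  also have "\<dots> = (\<Sum>I\<in>K. Poly_Mapping.lookup p I * c I)"
    using assms(2,3) by (rule sum.mono_neutral_left) (auto simp: in_keys_iff)
  finally show ?thesis .
qed

text \<open>If \<open>I\<close> is not a sentence over \<open>A\<close>, both sides are 0.\<close>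

lemma functional_of_H_basis:
  "c \<in> coeff_families A \<Longrightarrow> functional_of A c (H_basis I) = c I"
  by (simp add: functional_of_def H_basis_in_nsym_iff coeff_family_eq_zero)
    (simp add: H_basis_def)

lemma functional_of_inject:
  "\<lbrakk>c \<in> coeff_families A; d \<in> coeff_families A; functional_of A c = functional_of A d\<rbrakk> \<Longrightarrow> c = d"
  by (metis ext functional_of_H_basis)

lemma lookup_map_scale:
  "Poly_Mapping.lookup (Poly_Mapping.map (\<lambda>x. k * x) p) I = k * Poly_Mapping.lookup p I"
  for k :: "'k::field"
  by (simp add: map.rep_eq when_def)

lemma nsym_add: "p \<in> nsym A \<Longrightarrow> q \<in> nsym A \<Longrightarrow> p + q \<in> nsym A"
  using keys_add[of p q] by (auto simp: nsym_def)

lemma keys_map_scale: "Poly_Mapping.keys (Poly_Mapping.map (\<lambda>x. k * x) p) \<subseteq> Poly_Mapping.keys p"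
  for k :: "'k::field"
  by (auto simp: in_keys_iff lookup_map_scale)

lemma nsym_scale: "p \<in> nsym A \<Longrightarrow> Poly_Mapping.map (\<lambda>x. k * x) p \<in> nsym A"
  for k :: "'k::field"
  using keys_map_scale[of k p] by (auto simp: nsym_def)

lemma nsym_functional_functional_of: "nsym_functional A (functional_of A c)"
  unfolding nsym_functional_def
proof (intro conjI ballI allI impI)
  fix p q :: "'a sentence \<Rightarrow>\<^sub>0 'b"
  assume pq: "p \<in> nsym A" "q \<in> nsym A"
  let ?K = "Poly_Mapping.keys p \<union> Poly_Mapping.keys q"
  have "functional_of A c r = (\<Sum>I\<in>?K. Poly_Mapping.lookup r I * c I)"
    if "r = p \<or> r = q \<or> r = p + q" for r
    using that pq keys_add[of p q] by (intro functional_of_superset) (auto simp: nsym_add)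
  then show "functional_of A c (p + q) = functional_of A c p + functional_of A c q"
    by (simp add: lookup_add distrib_right sum.distrib)
next
  fix k and p :: "'a sentence \<Rightarrow>\<^sub>0 'b"
  assume "p \<in> nsym A"
  then show "functional_of A c (Poly_Mapping.map (\<lambda>x. k * x) p) = k * functional_of A c p"
    by (subst (1 2) functional_of_superset[where K = "Poly_Mapping.keys p"])
      (auto simp: nsym_scale keys_map_scale lookup_map_scale sum_distrib_left mult.assoc)
qed (simp add: functional_of_def)

text \<open>Inside \<open>nsym A\<close>, linearity and the expansion of \<open>p\<close> in the
  basis determine the value; outside it, both sides are 0 by convention.\<close>

lemma nsym_functional_eq_functional_of:
  assumes "nsym_functional A f"
  shows "f = functional_of A (\<lambda>I. f (H_basis I))"
proof
  fix p
  show "f p = functional_of A (\<lambda>I. f (H_basis I)) p"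
  proof (cases "p \<in> nsym A")
    case True
    have add: "f (p + q) = f p + f q" if "p \<in> nsym A" "q \<in> nsym A" for p q
      using assms that by (auto simp: nsym_functional_def)
    have scale: "f (Poly_Mapping.map (\<lambda>x. k * x) p) = k * f p" if "p \<in> nsym A" for k p
      using assms that by (auto simp: nsym_functional_def)
    have "f (0 + 0) = f 0 + f 0"
      by (rule add) (simp_all add: nsym_def)
    then have f0: "f 0 = 0"
      by (metis add.right_neutral add_left_cancel)
    have single: "f (Poly_Mapping.single I k) = k * f (H_basis I)" if "I \<in> sentences A" for I k
    proof -
      have "Poly_Mapping.single I k = Poly_Mapping.map (\<lambda>x. k * x) (H_basis I)"
        by (rule poly_mapping_eqI) (simp add: lookup_map_scale H_basis_def lookup_single when_def)
      with that show ?thesis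
        by (simp add: scale H_basis_in_nsym_iff)
    qed
    let ?p = "\<lambda>S. \<Sum>I\<in>S. Poly_Mapping.single I (Poly_Mapping.lookup p I)"
    \<comment> \<open>Membership is carried through the induction because \<open>f\<close> is
      additive only on \<open>nsym A\<close>.\<close>
    have "?p S \<in> nsym A \<and> f (?p S) = (\<Sum>I\<in>S. Poly_Mapping.lookup p I * f (H_basis I))"
      if "finite S" "S \<subseteq> sentences A" for S
      using that
    proof (induction S rule: finite_induct)
      case empty
      then show ?case by (simp add: f0 nsym_def)
    next
      case (insert I S)
      have "Poly_Mapping.single I (Poly_Mapping.lookup p I) \<in> nsym A"
        using insert.prems by (simp add: nsym_def)
      with insert show ?case
        by (simp add: nsym_add add single)
    qed
    from this[of "Poly_Mapping.keys p"] True
    have "f (?p (Poly_Mapping.keys p)) = functional_of A (\<lambda>I. f (H_basis I)) p"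
      by (simp add: nsym_def functional_of_def)
    moreover have "?p (Poly_Mapping.keys p) = p"
      by (rule poly_mapping_eqI)
        (auto simp: lookup_sum lookup_single when_def in_keys_iff)
    ultimately show ?thesis by simp
  next
    case False
    then show ?thesis
      using assms by (simp add: functional_of_def nsym_functional_def)
  qed
qed

text \<open>Since \<open>H_basis I\<close> is homogeneous of degree \<open>letters I\<close>,
  non-vanishing on finitely many components bounds the letters of the sentences with non-zero
  coefficient; conversely a bound \<open>d\<close> kills all components above
  \<open>d\<close>.\<close>

lemma gdual_carrier_eq:
  "carrier (nsym_gdual A) = functional_of A ` coeff_families A"
proof (intro equalityI subsetI)
  fix f :: "('a sentence \<Rightarrow>\<^sub>0 'b) \<Rightarrow> 'b"
  assume "f \<in> carrier (nsym_gdual A)"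
  then have f: "nsym_functional A f" and fin: "finite {n. \<exists>p\<in>nsym_homogeneous A n. f p \<noteq> 0}"
    by (auto simp: nsym_gdual_def)
  have sent: "I \<in> sentences A" if "f (H_basis I) \<noteq> 0" for I
    using f that by (metis H_basis_in_nsym_iff nsym_functional_def)
  have "letters I \<in> {n. \<exists>p\<in>nsym_homogeneous A n. f p \<noteq> 0}" if "f (H_basis I) \<noteq> 0" for I
  proof -
    have "H_basis I \<in> nsym_homogeneous A (letters I)"
      using sent[OF that] by (simp add: nsym_homogeneous_def H_basis_in_nsym_iff)
        (simp add: H_basis_def)
    with that show ?thesis by blast
  qed
  \<comment> \<open>If the set of degrees is empty, there is no non-zero coefficient and the value
    of \<open>Max\<close> is irrelevant.\<close>
  then have "\<forall>I. f (H_basis I) \<noteq> 0 \<longrightarrow> letters I \<le> Max {n. \<exists>p\<in>nsym_homogeneous A n. f p \<noteq> 0}"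
    using fin by (meson Max_ge)
  with sent have "(\<lambda>I. f (H_basis I)) \<in> coeff_families A"
    by (auto simp: coeff_families_def)
  then show "f \<in> functional_of A ` coeff_families A"
    using nsym_functional_eq_functional_of[OF f] by blast
next
  fix f :: "('a sentence \<Rightarrow>\<^sub>0 'b) \<Rightarrow> 'b"
  assume "f \<in> functional_of A ` coeff_families A"
  then obtain c where f: "f = functional_of A c" and c: "c \<in> coeff_families A"
    by auto
  obtain d where d: "\<forall>I. c I \<noteq> 0 \<longrightarrow> letters I \<le> d"
    using c by (auto simp: coeff_families_def)
  have "n \<le> d" if p: "p \<in> nsym_homogeneous A n" and nz: "f p \<noteq> 0" for n p
  proof -
    obtain I where "I \<in> Poly_Mapping.keys p" "Poly_Mapping.lookup p I * c I \<noteq> 0"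
      using nz by (auto simp: f functional_of_def split: if_splits
          elim!: sum.not_neutral_contains_not_neutral)
    then show ?thesis
      using p d by (auto simp: nsym_homogeneous_def)
  qed
  then have "{n. \<exists>p\<in>nsym_homogeneous A n. f p \<noteq> 0} \<subseteq> {..d}"
    by auto
  then have "finite {n. \<exists>p\<in>nsym_homogeneous A n. f p \<noteq> 0}"
    using finite_subset by blast
  then show "f \<in> carrier (nsym_gdual A)"
    using nsym_functional_functional_of[of A c] by (simp add: nsym_gdual_def f)
qed

section \<open>The operations of the graded dual in coordinates\<close>

lemma tensor_functional_superset:
  assumes "finite K" "Poly_Mapping.keys t \<subseteq> K"
  shows "tensor_functional f g t =
    (\<Sum>x\<in>K. Poly_Mapping.lookup t x * (f (H_basis (fst x)) * g (H_basis (snd x))))"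
proof -
  have "tensor_functional f g t =
      (\<Sum>x\<in>Poly_Mapping.keys t. Poly_Mapping.lookup t x * (f (H_basis (fst x)) * g (H_basis (snd x))))"
    by (simp add: tensor_functional_def case_prod_unfold)
  also have "\<dots> = (\<Sum>x\<in>K. Poly_Mapping.lookup t x * (f (H_basis (fst x)) * g (H_basis (snd x))))"
    using assms by (rule sum.mono_neutral_left) (auto simp: in_keys_iff)
  finally show ?thesis .
qed

lemma tensor_functional_add:
  "tensor_functional f g (s + t) = tensor_functional f g s + tensor_functional f g t"
proof -
  let ?K = "Poly_Mapping.keys s \<union> Poly_Mapping.keys t"
  have "tensor_functional f g r =
      (\<Sum>x\<in>?K. Poly_Mapping.lookup r x * (f (H_basis (fst x)) * g (H_basis (snd x))))"
    if "r = s \<or> r = t \<or> r = s + t" for r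
    using that keys_add[of s t] by (intro tensor_functional_superset) auto
  then show ?thesis
    by (simp add: lookup_add distrib_right sum.distrib)
qed

lemma tensor_functional_sum:
  "tensor_functional f g (\<Sum>x\<in>S. t x) = (\<Sum>x\<in>S. tensor_functional f g (t x))"
  by (induction S rule: infinite_finite_induct)
    (auto simp: tensor_functional_add, simp_all add: tensor_functional_def)

lemma tensor_functional_single:
  "tensor_functional f g (Poly_Mapping.single (I, J) k) = k * (f (H_basis I) * g (H_basis J))"
  by (subst tensor_functional_superset[where K = "{(I, J)}"]) auto

lemma functional_of_mult:
  assumes "c \<in> coeff_families A" "d \<in> coeff_families A"
  shows "functional_of A c \<otimes>\<^bsub>nsym_gdual A\<^esub> functional_of A d = functional_of A (convolution c d)"
proof
  fix p
  show "(functional_of A c \<otimes>\<^bsub>nsym_gdual A\<^esub> functional_of A d) p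
      = functional_of A (convolution c d) p"
  proof (cases "p \<in> nsym A")
    case True
    \<comment> \<open>On the keys of \<open>p\<close> the guard in \<open>convolution\<close> is
      off, so its value is the sum coming from the coproduct.\<close>
    then have "[] \<notin> set I" if "I \<in> Poly_Mapping.keys p" for I
      using that by (auto simp: nsym_def sentences_iff)
    with True show ?thesis
      by (simp add: nsym_gdual_def coproduct_def tensor_functional_sum tensor_functional_single
          functional_of_H_basis assms functional_of_def[of A "convolution c d"] convolution_def
          sum_distrib_left)
  qed (simp add: nsym_gdual_def functional_of_def)
qed

lemma functional_of_add:
  "functional_of A c \<oplus>\<^bsub>nsym_gdual A\<^esub> functional_of A d = functional_of A (\<lambda>I. c I + d I)"
  by (auto simp: nsym_gdual_def functional_of_def fun_eq_iff distrib_left sum.distrib)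

lemma functional_of_scale:
  "k \<odot>\<^bsub>nsym_gdual A\<^esub> functional_of A c = functional_of A (\<lambda>I. k * c I)"
  by (auto simp: nsym_gdual_def functional_of_def fun_eq_iff sum_distrib_left mult.left_commute)

lemma functional_of_coeff_unit: "functional_of A (coeff_unit I) = H_dual A I"
  by (auto simp: functional_of_def H_dual_def coeff_unit_def fun_eq_iff in_keys_iff if_distrib
      cong: if_cong)

lemma functional_of_one: "\<one>\<^bsub>nsym_gdual A\<^esub> = functional_of A (coeff_unit [])"
  by (simp add: functional_of_coeff_unit) (simp add: nsym_gdual_def)

section \<open>The isomorphism\<close>

theorem proposition4p2:
  fixes A :: "'a set"
  assumes "finite A"
  shows "is_subalgebra (QSym A) (pc_series A :: ('k::field_char_0, 'a pc_monomial \<Rightarrow> 'k) module) \<and>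
    (\<exists>\<phi> \<in> algebra_iso ((pc_series A :: ('k, 'a pc_monomial \<Rightarrow> 'k) module)\<lparr>carrier := QSym A\<rparr>)
                      (nsym_gdual A).
       \<forall>I\<in>sentences A. \<phi> (M_series I) = H_dual A I)"
proof (intro conjI bexI ballI)
  show "is_subalgebra (QSym A) (pc_series A :: ('k, 'a pc_monomial \<Rightarrow> 'k) module)"
    using assms by (rule QSym_subalgebra)
  let ?C = "coeff_families A :: ('a sentence \<Rightarrow> 'k) set"
  let ?Q = "(pc_series A :: ('k, 'a pc_monomial \<Rightarrow> 'k) module)\<lparr>carrier := QSym A\<rparr>"
  \<comment> \<open>A series is first replaced by its coordinates, which are then read as values on
    the basis \<open>H_basis I\<close>.\<close>
  define \<phi> :: "('a pc_monomial \<Rightarrow> 'k) \<Rightarrow> ('a sentence \<Rightarrow>\<^sub>0 'k) \<Rightarrow> 'k" where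
    "\<phi> = functional_of A \<circ> inv_into ?C series_of"
  have inj: "inj_on series_of ?C"
    by (auto intro!: inj_onI series_of_inject)
  have phi: "\<phi> (series_of c) = functional_of A c" if "c \<in> ?C" for c
    using that inj by (simp add: \<phi>_def)
  have "bij_betw (inv_into ?C series_of) (series_of ` ?C) ?C"
    using inj by (intro bij_betw_inv_into) (simp add: bij_betw_def)
  moreover have "bij_betw (functional_of A) ?C (carrier (nsym_gdual A))"
    by (auto simp: bij_betw_def gdual_carrier_eq intro!: inj_onI functional_of_inject)
  ultimately have bij: "bij_betw \<phi> (carrier ?Q) (carrier (nsym_gdual A))"
    unfolding \<phi>_def by (simp add: QSym_eq[OF assms] bij_betw_trans)
  have "[] \<in> sentences A"
    by (simp add: sentences_def)
  then have one: "\<phi> \<one>\<^bsub>?Q\<^esub> = \<one>\<^bsub>nsym_gdual A\<^esub>"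
    using phi[OF coeff_unit_in] series_of_one[of A, where 'b = 'k] by (simp add: functional_of_one)
  have "\<phi> \<in> ring_hom ?Q (nsym_gdual A)"
  proof (rule ring_hom_memI)
    show "\<phi> x \<in> carrier (nsym_gdual A)" if "x \<in> carrier ?Q" for x
      using bij that by (rule bij_betw_apply)
    \<comment> \<open>By \<open>QSym_eq\<close> all elements have the form
      \<open>series_of c\<close>, and both products become the same \<open>convolution\<close> of
      coordinates.\<close>
    show "\<phi> (x \<otimes>\<^bsub>?Q\<^esub> y) = \<phi> x \<otimes>\<^bsub>nsym_gdual A\<^esub> \<phi> y" if "x \<in> carrier ?Q" "y \<in> carrier ?Q" for x y
      using that
      by (auto simp: QSym_eq[OF assms] series_of_mult functional_of_mult phi convolution_in_coeff_families)
    show "\<phi> \<one>\<^bsub>?Q\<^esub> = \<one>\<^bsub>nsym_gdual A\<^esub>"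
      by (fact one)
    show "\<phi> (x \<oplus>\<^bsub>?Q\<^esub> y) = \<phi> x \<oplus>\<^bsub>nsym_gdual A\<^esub> \<phi> y" if "x \<in> carrier ?Q" "y \<in> carrier ?Q" for x y
      using that
      by (auto simp: QSym_eq[OF assms] series_of_add functional_of_add phi add_in_coeff_families)
  qed
  moreover have "\<phi> (k \<odot>\<^bsub>?Q\<^esub> x) = k \<odot>\<^bsub>nsym_gdual A\<^esub> \<phi> x" if "x \<in> carrier ?Q" for k x
    using that
    by (auto simp: QSym_eq[OF assms] series_of_scale functional_of_scale phi scale_in_coeff_families)
  ultimately show "\<phi> \<in> algebra_iso ?Q (nsym_gdual A)"
    using bij by (simp add: algebra_iso_def ring_iso_def)
  show "\<phi> (M_series I) = H_dual A I" if "I \<in> sentences A" for I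
    using that by (simp add: M_series_eq_series_of phi coeff_unit_in functional_of_coeff_unit)
qed

end
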